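(* Let $X$ be a finite set and $\mathfrak p\subseteq 2^X$ satisfy: (a) if $A\in\mathfrak p$ and $B\subset A$ then $B\in\mathfrak p$; (b) for $A\subseteq X$ with $|A|\ge 2$, if $\{x,y\}\in\mathfrak p$ for all distinct $x,y\in A$ then $A\in\mathfrak p$; (c) $\{x\}\in\mathfrak p$ for every $x\in X$. Suppose $(X,\mathfrak p)$ is symmetric and connected. Let $A_1,\dots,A_m\subseteq X$ form a cross-$\mathfrak p$-family with $A_1\neq\emptyset$. Then $$\sum_{i=1}^m|A_i|\le\begin{cases}|X| & \text{if } m\le \frac{|X|}{\alpha(X,\mathfrak p)},\\ m\,\alpha(X,\mathfrak p) & \text{if } m\ge \frac{|X|}{\alpha(X,\mathfrak p)},\end{cases}$$ and the bound is attained if and only if one of the following holds: (i) $m<\frac{|X|}{\alpha(X,\mathfrak p)}$ and $A_1=X$, $A_2=\dots=A_m=\emptyset$; (ii) $m>\frac{|X|}{\alpha(X,\mathfrak p)}$ and $A_1=\dots=A_m=I$ for some $I\in\mathfrak p$ with $|I|=\alpha(X,\mathfrak p)$; (iii) $m=\frac{|X|}{\alpha(X,\mathfrak p)}$ and either $A_1,\dots,A_m$ are as in (i) or as in (ii), or there is an imprimitive $\mathfrak p$-subset $A$ such that $A\subseteq A_i$ for all $i=1,\dots,m$, and, writing $A_i'=A_i\setminus A$, the family $\{A_1',\dots,A_m'\}$ is a cross-$\mathfrak p$-family and a partition of $\bar N[A]$.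
   Context: $(X,\mathfrak p)$ is symmetric if there is a group $\Gamma$ acting transitively on $X$ such that $\delta(A)\in\mathfrak p$ for every $A\in\mathfrak p$ and $\delta\in\Gamma$. $(X,\mathfrak p)$ is connected if the simple graph with vertex set $X$ in which distinct $a,b$ are adjacent iff $\{a,b\}\notin\mathfrak p$ is connected. A family $\{A_1,\dots,A_m\}$ of subsets of $X$ is a cross-$\mathfrak p$-family if $\{a,b\}\in\mathfrak p$ for all $a\in A_i$, $b\in A_j$ with $i\neq j$. $\alpha(X,\mathfrak p)=\max\{|B|:B\in\mathfrak p\}$. For $A\subseteq X$, $N[A]=A\cup\{b\in X:\{a,b\}\notin\mathfrak p\text{ for some }a\in A\}$ and $\bar N[A]=X\setminus N[A]$. A nonempty $A\in\mathfrak p$ is an imprimitive $\mathfrak p$-subset if $|A|<\alpha(X,\mathfrak p)$ and $\frac{|A|}{|N[A]|}=\frac{\alpha(X,\mathfrak p)}{|X|}$. *)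

theory Defs
  imports
    Complex_Main
    "HOL-Library.Disjoint_Sets"
    "HOL-Algebra.Group_Action"
    "Graph_Theory.Digraph_Component"
begin

text \<open>The existential ranges over groups whose elements have type \<open>'g\<close>. A theorem that assumes
  \<open>symmetric_system TYPE('g) X P\<close> for a free type variable \<open>'g\<close> therefore covers groups with
  elements of any type.\<close>

definition symmetric_system :: "'g itself \<Rightarrow> 'a set \<Rightarrow> 'a set set \<Rightarrow> bool" where
  "symmetric_system (_ :: 'g itself) X P \<longleftrightarrow>
     (\<exists>(\<Gamma> :: 'g monoid) \<phi>. transitive_action \<Gamma> X \<phi> \<and>
        (\<forall>\<delta> \<in> carrier \<Gamma>. \<forall>A \<in> P. \<phi> \<delta> ` A \<in> P))"

text \<open>A simple graph is encoded as a loop-free symmetric digraph, each edge giving two opposite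
  arcs.\<close>

definition system_graph :: "'a set \<Rightarrow> 'a set set \<Rightarrow> 'a pair_pre_digraph" where
  "system_graph X P =
     \<lparr>pverts = X, parcs = {(a, b). a \<in> X \<and> b \<in> X \<and> a \<noteq> b \<and> {a, b} \<notin> P}\<rparr>"

lemma pair_graph_system_graph:
  assumes "finite X"
  shows "pair_graph (system_graph X P)"
proof
  show "finite (parcs (system_graph X P))"
    by (rule finite_subset[of _ "X \<times> X"]) (auto simp: system_graph_def assms)
  show "symmetric (with_proj (system_graph X P))"
    by (auto simp: system_graph_def symmetric_def arcs_ends_def arc_to_ends_def sym_def
        insert_commute)
qed (auto simp: system_graph_def assms)

definition connected_system :: "'a set \<Rightarrow> 'a set set \<Rightarrow> bool" where
  "connected_system X P \<longleftrightarrow> Digraph_Component.connected (with_proj (system_graph X P))"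

definition cross_family :: "'a set \<Rightarrow> 'a set set \<Rightarrow> nat \<Rightarrow> (nat \<Rightarrow> 'a set) \<Rightarrow> bool" where
  "cross_family X P m A \<longleftrightarrow>
     (\<forall>i \<in> {1..m}. A i \<subseteq> X) \<and>
     (\<forall>i \<in> {1..m}. \<forall>j \<in> {1..m}. i \<noteq> j \<longrightarrow> (\<forall>a \<in> A i. \<forall>b \<in> A j. {a, b} \<in> P))"

definition alpha :: "'a set set \<Rightarrow> nat" where
  "alpha P = Max (card ` P)"

definition closed_nbhd :: "'a set \<Rightarrow> 'a set set \<Rightarrow> 'a set \<Rightarrow> 'a set" where
  "closed_nbhd X P A = A \<union> {b \<in> X. \<exists>a \<in> A. {a, b} \<notin> P}"

definition imprimitive_subset :: "'a set \<Rightarrow> 'a set set \<Rightarrow> 'a set \<Rightarrow> bool" where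
  "imprimitive_subset X P A \<longleftrightarrow>
     A \<in> P \<and> A \<noteq> {} \<and> card A < alpha P \<and>
     real (card A) / real (card (closed_nbhd X P A)) = real (alpha P) / real (card X)"

text \<open>The parts of an indexed partition may be empty, in contrast to \<open>partition_on\<close>. The
  characterisation of equality needs this: if \<open>A\<close> is imprimitive and \<open>m = |X| / alpha P\<close>, the family
  \<open>A \<union> (X - N[A]), A, \<dots>, A\<close> attains the bound, and it induces the parts
  \<open>X - N[A], \<emptyset>, \<dots>, \<emptyset>\<close>.\<close>

definition indexed_partition :: "nat \<Rightarrow> (nat \<Rightarrow> 'a set) \<Rightarrow> 'a set \<Rightarrow> bool" where
  "indexed_partition m A S \<longleftrightarrow> disjoint_family_on A {1..m} \<and> (\<Union>i \<in> {1..m}. A i) = S"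

end

theory Submission
  imports Defs
begin

text \<open>View \<open>P\<close> as the independent sets of the graph \<open>system_graph X P\<close>. Averaging
  \<open>|\<gamma> I \<inter> N[B]|\<close> over all translates \<open>\<gamma> I\<close> of a maximum independent set \<open>I\<close> gives
  \<open>|B| / |N[B]| \<le> alpha P / |X|\<close> for every independent \<open>B\<close>, because
  \<open>(\<gamma> I - N[B]) \<union> B\<close> is independent. In a cross family let \<open>B\<close> be the set of elements that lie in at
  least two members. Then \<open>B\<close> is independent, no element of any member is adjacent to \<open>B\<close>, and the
  elements outside \<open>B\<close> are counted once, so the sum of the sizes is at most
  \<open>m |B| + |X| - |N[B]|\<close>. Both bounds and the equality cases follow from this and the inequality
  above, connectedness being needed only when \<open>B\<close> is empty.\<close>

section \<open>Counting translates under a transitive action\<close>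

text \<open>The group may be infinite, so averages are taken over the set of permutations it
  induces; these are extensional maps from \<open>E\<close> to \<open>E\<close>, of which there are
  finitely many.\<close>

lemma (in group_action) finite_translates:
  assumes "finite E"
  shows "finite (\<phi> ` carrier G)"
proof -
  have "\<phi> ` carrier G \<subseteq> E \<rightarrow>\<^sub>E E"
    using bij_prop0 by (auto simp: PiE_def dest: Bij_imp_funcset Bij_imp_extensional)
  then show ?thesis using assms by (meson finite_PiE finite_subset)
qed

text \<open>All fibres of the map sending a translate \<open>f\<close> to \<open>f x\<close> have
  the same size, since composing with a group element that moves \<open>y\<close> to
  \<open>z\<close> injects the fibre over \<open>y\<close> into the fibre over
  \<open>z\<close>.\<close>

lemma (in transitive_action) card_translates_into:
  assumes "finite E" "x \<in> E" "N \<subseteq> E"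
  shows "card {f \<in> \<phi> ` carrier G. f x \<in> N} * card E = card N * card (\<phi> ` carrier G)"
proof -
  let ?F = "\<phi> ` carrier G"
  interpret G: group G by (rule group_hom.axioms(1)[OF group_hom])
  interpret S: group "BijGroup E" by (rule group_BijGroup)
  note hom_closed = group_hom.hom_closed[OF group_hom]
  have finF: "finite ?F" by (rule finite_translates[OF assms(1)])
  have le: "card {f \<in> ?F. f x = y} \<le> card {f \<in> ?F. f x = z}" if yz: "y \<in> E" "z \<in> E" for y z
  proof -
    obtain g where g: "g \<in> carrier G" "\<phi> g y = z" using unique_orbit[OF yz] ..
    let ?t = "\<lambda>f. \<phi> g \<otimes>\<^bsub>BijGroup E\<^esub> f"
    have "inj_on ?t {f \<in> ?F. f x = y}"
    proof (rule inj_onI)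
      fix f f' assume f: "f \<in> {f \<in> ?F. f x = y}" "f' \<in> {f \<in> ?F. f x = y}"
        and eq: "?t f = ?t f'"
      have "f \<in> carrier (BijGroup E)" "f' \<in> carrier (BijGroup E)" using f hom_closed by auto
      moreover have "\<phi> g \<in> Units (BijGroup E)" using g(1) hom_closed by (simp add: S.Units_eq)
      ultimately show "f = f'" using eq by (simp only: S.Units_l_cancel)
    qed
    moreover have "?t ` {f \<in> ?F. f x = y} \<subseteq> {f \<in> ?F. f x = z}"
    proof (rule image_subsetI)
      fix f assume "f \<in> {f \<in> ?F. f x = y}"
      then obtain h where h: "h \<in> carrier G" "f = \<phi> h" "\<phi> h x = y" by blast
      have "\<phi> g \<otimes>\<^bsub>BijGroup E\<^esub> \<phi> h = \<phi> (g \<otimes> h)"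
        using group_hom.hom_mult[OF group_hom g(1) h(1)] by simp
      moreover have "\<phi> (g \<otimes> h) \<in> ?F" using g(1) h(1) by (intro imageI G.m_closed)
      moreover have "\<phi> (g \<otimes> h) x = z"
        using composition_rule[OF assms(2) g(1) h(1)] g(2) h(3) by simp
      ultimately show "?t f \<in> {f \<in> ?F. f x = z}" using h(2) by simp
    qed
    moreover have "finite {f \<in> ?F. f x = z}" using finF by simp
    ultimately show ?thesis by (rule card_inj_on_le)
  qed
  have fibres: "card {f \<in> ?F. f x \<in> M} = card M * card {f \<in> ?F. f x = x}" if "M \<subseteq> E" for M
  proof -
    have "finite M" using that assms(1) finite_subset by blast
    moreover have "{f \<in> ?F. f x \<in> M} = (\<Union>y\<in>M. {f \<in> ?F. f x = y})" by auto
    ultimately have "card {f \<in> ?F. f x \<in> M} = (\<Sum>y\<in>M. card {f \<in> ?F. f x = y})"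
      using finF by (simp only:) (intro card_UN_disjoint; auto)
    also have "\<dots> = (\<Sum>y\<in>M. card {f \<in> ?F. f x = x})"
      using le that assms(2) by (intro sum.cong refl le_antisym) blast+
    finally show ?thesis by simp
  qed
  \<comment> \<open>Taking \<open>M = E\<close> determines the common fibre size, which can then be
    eliminated from the count for \<open>N\<close>.\<close>
  have "{f \<in> ?F. f x \<in> E} = ?F" using element_image[OF _ assms(2) refl] by auto
  then have "card ?F = card E * card {f \<in> ?F. f x = x}" using fibres[of E] by simp
  then show ?thesis using fibres[OF assms(3)] by simp
qed

text \<open>Double counting of the pairs \<open>(f, x)\<close> with \<open>x \<in> I\<close> and
  \<open>f x \<in> N\<close>: each \<open>f\<close> is injective and contributes the size of the
  intersection, while each \<open>x\<close> contributes the count from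
  \<open>card_translates_into\<close>.\<close>

lemma (in transitive_action) sum_card_translate_inter:
  assumes "finite E" "I \<subseteq> E" "N \<subseteq> E"
  shows "(\<Sum>f \<in> \<phi> ` carrier G. card (f ` I \<inter> N)) * card E
    = card I * card N * card (\<phi> ` carrier G)"
proof -
  let ?F = "\<phi> ` carrier G"
  have finI: "finite I" using assms finite_subset by blast
  have "card (f ` I \<inter> N) = (\<Sum>x\<in>I. of_bool (f x \<in> N))" if "f \<in> ?F" for f
  proof -
    have "inj_on f I" using that inj_prop assms(2) inj_on_subset by blast
    then have "inj_on f {x \<in> I. f x \<in> N}" by (rule inj_on_subset) auto
    moreover have "f ` I \<inter> N = f ` {x \<in> I. f x \<in> N}" by auto
    ultimately show ?thesis using finI by (simp add: card_image Int_def)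
  qed
  then have "(\<Sum>f\<in>?F. card (f ` I \<inter> N)) = (\<Sum>x\<in>I. \<Sum>f\<in>?F. of_bool (f x \<in> N))"
    by (simp add: sum.swap[of _ I])
  also have "\<dots> = (\<Sum>x\<in>I. card {f \<in> ?F. f x \<in> N})"
    using finite_translates[OF assms(1)] by (simp add: Int_def)
  finally have "(\<Sum>f\<in>?F. card (f ` I \<inter> N)) * card E
      = (\<Sum>x\<in>I. card {f \<in> ?F. f x \<in> N} * card E)"
    by (simp add: sum_distrib_right)
  also have "\<dots> = (\<Sum>x\<in>I. card N * card ?F)"
    using card_translates_into assms by (intro sum.cong refl) blast
  finally show ?thesis by simp
qed

section \<open>Set systems as independent sets of a graph\<close>

text \<open>Nonemptiness of \<open>X\<close> makes \<open>alpha P\<close> positive, so that it can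
  be cancelled; in the theorem it comes from \<open>m \<ge> 1\<close> and
  \<open>A 1 \<noteq> {}\<close>.\<close>

locale p_system =
  fixes X :: "'a set" and P :: "'a set set"
  assumes finite_X: "finite X"
    and P_subset: "P \<subseteq> Pow X"
    and down_closed: "\<And>B C. C \<in> P \<Longrightarrow> B \<subseteq> C \<Longrightarrow> B \<in> P"
    and pairwise_closed: "\<And>B. B \<subseteq> X \<Longrightarrow> card B \<ge> 2 \<Longrightarrow>
           (\<forall>x \<in> B. \<forall>y \<in> B. x \<noteq> y \<longrightarrow> {x, y} \<in> P) \<Longrightarrow> B \<in> P"
    and singleton_in: "\<And>x. x \<in> X \<Longrightarrow> {x} \<in> P"
    and nonempty: "X \<noteq> {}"
begin

lemma finite_P: "finite P"
  using finite_X P_subset by (meson finite_Pow_iff finite_subset)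

text \<open>The case \<open>x = y\<close> is the singleton condition, and a set with fewer than two
  elements lies below a singleton, so pairs decide membership at every size.\<close>

lemma in_P_iff:
  assumes "B \<subseteq> X"
  shows "B \<in> P \<longleftrightarrow> (\<forall>x\<in>B. \<forall>y\<in>B. {x, y} \<in> P)"
proof
  assume "B \<in> P"
  then show "\<forall>x\<in>B. \<forall>y\<in>B. {x, y} \<in> P" by (auto intro: down_closed)
next
  assume pairs: "\<forall>x\<in>B. \<forall>y\<in>B. {x, y} \<in> P"
  have "finite B" using assms finite_X finite_subset by blast
  show "B \<in> P"
  proof (cases "card B \<ge> 2")
    case True
    then show ?thesis using assms pairs pairwise_closed by blast
  next
    case False
    then have "card B = 0 \<or> card B = 1" by linarith
    then have "\<exists>x\<in>X. B \<subseteq> {x}"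
      using assms nonempty \<open>finite B\<close> by (auto simp: card_1_singleton_iff)
    then show ?thesis using singleton_in down_closed by blast
  qed
qed

lemma card_le_alpha: "B \<in> P \<Longrightarrow> card B \<le> alpha P"
  unfolding alpha_def using finite_P by simp

lemma alpha_attained:
  obtains I where "I \<in> P" "card I = alpha P"
proof -
  have "P \<noteq> {}" using nonempty singleton_in by blast
  then have "alpha P \<in> card ` P" unfolding alpha_def using finite_P by (intro Max_in) auto
  then show ?thesis using that by auto
qed

lemma alpha_pos: "alpha P > 0"
proof -
  obtain x where "x \<in> X" using nonempty by blast
  then show ?thesis using card_le_alpha[OF singleton_in] by fastforce
qed

lemma closed_nbhd_subset: "B \<subseteq> X \<Longrightarrow> closed_nbhd X P B \<subseteq> X"
  by (auto simp: closed_nbhd_def)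

lemma finite_closed_nbhd: "B \<subseteq> X \<Longrightarrow> finite (closed_nbhd X P B)"
  using closed_nbhd_subset finite_X finite_subset by blast

text \<open>Exchange argument: removing from \<open>I\<close> its part in the closed neighbourhood
  of \<open>B\<close> and inserting \<open>B\<close> leaves an independent set, which cannot be
  larger than the maximum set \<open>I\<close>.\<close>

lemma card_le_card_inter_closed_nbhd:
  assumes "B \<in> P" "I \<in> P" "card I = alpha P"
  shows "card B \<le> card (I \<inter> closed_nbhd X P B)"
proof -
  let ?N = "closed_nbhd X P B"
  have sub: "B \<subseteq> X" "I \<subseteq> X" using assms P_subset by auto
  then have fin: "finite B" "finite I" using finite_X finite_subset by blast+
  have "B \<union> (I - ?N) \<in> P"
  proof (subst in_P_iff)
    show "B \<union> (I - ?N) \<subseteq> X" using sub by auto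
    have "{x, y} \<in> P" if "x \<in> B" "y \<in> I - ?N" for x y
      using that sub by (auto simp: closed_nbhd_def)
    then show "\<forall>x\<in>B \<union> (I - ?N). \<forall>y\<in>B \<union> (I - ?N). {x, y} \<in> P"
      using assms(1,2) in_P_iff[OF sub(1)] in_P_iff[OF sub(2)]
      by (metis DiffD1 UnE insert_commute)
  qed
  then have "card (B \<union> (I - ?N)) \<le> card I" using assms(3) card_le_alpha by simp
  moreover have "card (B \<union> (I - ?N)) = card B + card (I - ?N)"
    using fin by (intro card_Un_disjoint) (auto simp: closed_nbhd_def)
  moreover have "card I = card (I \<inter> ?N) + card (I - ?N)"
    using fin(2) by (metis card_Int_Diff)
  ultimately show ?thesis by linarith
qed

text \<open>Every translate of a maximum independent set is again one, so the exchange inequality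
  can be summed over all translates and the sum evaluated by double counting. Cross-multiplication
  keeps the ratio inequality in the natural numbers.\<close>

lemma card_ratio_closed_nbhd:
  assumes "symmetric_system TYPE('g) X P" "B \<in> P"
  shows "card B * card X \<le> alpha P * card (closed_nbhd X P B)"
proof -
  let ?N = "closed_nbhd X P B"
  obtain \<Gamma> :: "'g monoid" and \<phi> where act: "transitive_action \<Gamma> X \<phi>"
    and inv: "\<And>\<delta> C. \<delta> \<in> carrier \<Gamma> \<Longrightarrow> C \<in> P \<Longrightarrow> \<phi> \<delta> ` C \<in> P"
    using assms(1) unfolding symmetric_system_def by blast
  interpret transitive_action \<Gamma> X \<phi> by (rule act)
  let ?F = "\<phi> ` carrier \<Gamma>"
  obtain I where I: "I \<in> P" "card I = alpha P" by (rule alpha_attained)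
  have sub: "I \<subseteq> X" "B \<subseteq> X" using I assms(2) P_subset by auto
  have each: "card B \<le> card (f ` I \<inter> ?N)" if "f \<in> ?F" for f
  proof (rule card_le_card_inter_closed_nbhd)
    show "f ` I \<in> P" using that inv I(1) by blast
    have "inj_on f I" using that inj_prop sub(1) inj_on_subset by blast
    then show "card (f ` I) = alpha P" using I(2) by (simp add: card_image)
  qed (rule assms)
  have "finite ?F" by (rule finite_translates[OF finite_X])
  moreover have "?F \<noteq> {}"
    using nonempty unique_orbit by blast
  ultimately have pos: "card ?F > 0" by (simp add: card_gt_0_iff)
  have "card ?F * card B \<le> (\<Sum>f\<in>?F. card (f ` I \<inter> ?N))"
    using sum_mono[of ?F "\<lambda>_. card B"] each by simp
  then have "card ?F * card B * card X \<le> (\<Sum>f\<in>?F. card (f ` I \<inter> ?N)) * card X"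
    by (rule mult_le_mono1)
  also have "\<dots> = card I * card ?N * card ?F"
    using sum_card_translate_inter[OF finite_X sub(1) closed_nbhd_subset[OF sub(2)]] .
  finally have "card ?F * (card B * card X) \<le> card ?F * (alpha P * card ?N)"
    using I(2) by (simp add: ac_simps)
  then show ?thesis using pos by simp
qed

text \<open>No edge leaves \<open>S\<close>, so a path that starts in \<open>S\<close> stays in
  \<open>S\<close>.\<close>

lemma connected_component_eq:
  assumes "connected_system X P" "S \<subseteq> X" "S \<noteq> {}"
    and closed: "\<And>a b. a \<in> S \<Longrightarrow> b \<in> X - S \<Longrightarrow> {a, b} \<in> P"
  shows "S = X"
proof -
  let ?G = "with_proj (system_graph X P)"
  interpret pair_graph "system_graph X P" by (rule pair_graph_system_graph[OF finite_X])
  \<comment> \<open>Arcs come in opposite pairs, so connectedness yields directed reachability,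
    which supports induction along a path.\<close>
  have "strongly_connected ?G"
    using assms(1) sym_arcs unfolding connected_system_def
    by (intro symmetric_connected_imp_strongly_connected) auto
  then have reach: "u \<rightarrow>\<^sup>*\<^bsub>?G\<^esub> v" if "u \<in> X" "v \<in> X" for u v
    using that by (auto simp: strongly_connected_def system_graph_def)
  obtain a where a: "a \<in> S" using assms(3) by blast
  have "b \<in> S" if "b \<in> X" for b
  proof -
    have "a \<rightarrow>\<^sup>*\<^bsub>?G\<^esub> b" using reach a that assms(2) by blast
    then show ?thesis
    proof (induction rule: reachable_induct)
      case base
      then show ?case using a by simp
    next
      case (step x y)
      then show ?case using closed[of x y] by (auto simp: system_graph_def)
    qed
  qed
  then show ?thesis using assms(2) by blast
qed

end

section \<open>Elements repeated in a cross family\<close>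

definition repeated :: "nat \<Rightarrow> (nat \<Rightarrow> 'a set) \<Rightarrow> 'a set" where
  "repeated m A = {x. \<exists>i\<in>{1..m}. \<exists>j\<in>{1..m}. i \<noteq> j \<and> x \<in> A i \<and> x \<in> A j}"

lemma repeated_subset_Union: "repeated m A \<subseteq> (\<Union>i\<in>{1..m}. A i)"
  by (auto simp: repeated_def)

lemma disjoint_family_minus_repeated: "disjoint_family_on (\<lambda>i. A i - repeated m A) {1..m}"
  by (auto simp: disjoint_family_on_def repeated_def)

text \<open>This serves the converse of case (iii), where \<open>B\<close> is a given imprimitive
  subset that has not been identified with \<open>repeated m A\<close>.\<close>

lemma sum_card_eq_common:
  assumes "\<And>i. i \<in> {1..m} \<Longrightarrow> finite (A i)"
    and "\<And>i. i \<in> {1..m} \<Longrightarrow> B \<subseteq> A i"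
    and "disjoint_family_on (\<lambda>i. A i - B) {1..m}"
  shows "(\<Sum>i=1..m. card (A i)) = m * card B + card (\<Union>i\<in>{1..m}. A i - B)"
proof -
  have "card (A i) = card B + card (A i - B)" if "i \<in> {1..m}" for i
    using assms(1,2)[OF that] by (metis card_Diff_subset card_mono finite_subset le_add_diff_inverse)
  then have "(\<Sum>i=1..m. card (A i)) = (\<Sum>i=1..m. card B + card (A i - B))"
    by (intro sum.cong) auto
  also have "\<dots> = m * card B + (\<Sum>i=1..m. card (A i - B))" by (simp add: sum.distrib)
  also have "(\<Sum>i=1..m. card (A i - B)) = card (\<Union>i\<in>{1..m}. A i - B)"
    using assms(1,3) by (subst card_UN_disjoint) (auto simp: disjoint_family_on_def)
  finally show ?thesis .
qed

context p_system
begin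

context
  fixes m :: nat and A :: "nat \<Rightarrow> 'a set" and B :: "'a set"
  assumes cross: "cross_family X P m A"
  defines "B \<equiv> repeated m A"
begin

lemma member_subset: "i \<in> {1..m} \<Longrightarrow> A i \<subseteq> X"
  using cross by (simp add: cross_family_def)

text \<open>Of the two members that contain \<open>b\<close>, at least one has an index other than
  \<open>i\<close>, and the cross condition applies between it and \<open>A i\<close>, even if
  \<open>b\<close> lies in \<open>A i\<close> too.\<close>

lemma repeated_nonadjacent:
  assumes "b \<in> B" "i \<in> {1..m}" "a \<in> A i"
  shows "{b, a} \<in> P"
proof -
  obtain j where "j \<in> {1..m}" "j \<noteq> i" "b \<in> A j"
    using assms(1) unfolding B_def repeated_def by blast
  then show ?thesis using cross assms(2,3) by (auto simp: cross_family_def)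
qed

lemma repeated_subset: "B \<subseteq> X"
  using repeated_subset_Union member_subset unfolding B_def by fastforce

lemma repeated_in_P: "B \<in> P"
  using repeated_subset_Union[of m A] repeated_nonadjacent
  by (subst in_P_iff[OF repeated_subset]) (auto simp: B_def)

lemma Union_minus_repeated_subset: "(\<Union>i\<in>{1..m}. A i - B) \<subseteq> X - closed_nbhd X P B"
  using member_subset repeated_nonadjacent by (fastforce simp: closed_nbhd_def)

lemma finite_member: "i \<in> {1..m} \<Longrightarrow> finite (A i)"
  using member_subset finite_X finite_subset by blast

lemma sum_card_cross_family:
  "(\<Sum>i=1..m. card (A i)) = (\<Sum>i=1..m. card (A i \<inter> B)) + card (\<Union>i\<in>{1..m}. A i - B)"
proof -
  have "(\<Sum>i=1..m. card (A i)) = (\<Sum>i=1..m. card (A i \<inter> B) + card (A i - B))"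
    using finite_member by (intro sum.cong refl card_Int_Diff) auto
  also have "\<dots> = (\<Sum>i=1..m. card (A i \<inter> B)) + (\<Sum>i=1..m. card (A i - B))"
    by (rule sum.distrib)
  also have "(\<Sum>i=1..m. card (A i - B)) = card (\<Union>i\<in>{1..m}. A i - B)"
    using finite_member disjoint_family_minus_repeated[of A m]
    by (subst card_UN_disjoint) (auto simp: disjoint_family_on_def B_def)
  finally show ?thesis .
qed

lemma finite_repeated: "finite B"
  using repeated_subset finite_X finite_subset by blast

lemma sum_card_inter_le: "(\<Sum>i=1..m. card (A i \<inter> B)) \<le> m * card B"
  using sum_mono[of "{1..m}" "\<lambda>i. card (A i \<inter> B)" "\<lambda>_. card B"] finite_repeated
  by (simp add: card_mono)

lemma card_Union_minus_le:
  "card (\<Union>i\<in>{1..m}. A i - B) + card (closed_nbhd X P B) \<le> card X"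
proof -
  have "card (\<Union>i\<in>{1..m}. A i - B) \<le> card (X - closed_nbhd X P B)"
    using Union_minus_repeated_subset finite_X by (intro card_mono) auto
  also have "\<dots> = card X - card (closed_nbhd X P B)"
    by (intro card_Diff_subset finite_closed_nbhd closed_nbhd_subset repeated_subset)
  finally show ?thesis
    using card_mono[OF finite_X closed_nbhd_subset[OF repeated_subset]] by linarith
qed

text \<open>Two estimates are added: each member meets \<open>B\<close> in at most
  \<open>card B\<close> elements, and the disjoint remainders avoid the closed neighbourhood of
  \<open>B\<close>. The additive form avoids truncated subtraction.\<close>

lemma sum_card_le:
  "(\<Sum>i=1..m. card (A i)) + card (closed_nbhd X P B) \<le> m * card B + card X"
  using sum_card_cross_family sum_card_inter_le card_Union_minus_le by linarith

text \<open>Equality in the sum forces equality in both estimates behind \<open>sum_card_le\<close>;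
  the first then gives the inclusions, the second the exhaustion of the complement.\<close>

lemma sum_card_eqD:
  assumes "(\<Sum>i=1..m. card (A i)) + card (closed_nbhd X P B) = m * card B + card X"
  shows "\<And>i. i \<in> {1..m} \<Longrightarrow> B \<subseteq> A i"
    and "(\<Union>i\<in>{1..m}. A i - B) = X - closed_nbhd X P B"
proof -
  have eqs: "(\<Sum>i=1..m. card (A i \<inter> B)) = m * card B"
    "card (\<Union>i\<in>{1..m}. A i - B) + card (closed_nbhd X P B) = card X"
    using assms sum_card_cross_family sum_card_inter_le card_Union_minus_le by linarith+
  show "B \<subseteq> A i" if "i \<in> {1..m}" for i
  proof (rule ccontr)
    assume "\<not> B \<subseteq> A i"
    then have "card (A i \<inter> B) < card B" using finite_repeated by (intro psubset_card_mono) auto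
    then have "(\<Sum>i=1..m. card (A i \<inter> B)) < (\<Sum>i=1..m. card B)"
      using that finite_repeated by (intro sum_strict_mono_ex1) (auto intro: card_mono)
    then show False using eqs(1) by simp
  qed
  have "card (X - closed_nbhd X P B) = card X - card (closed_nbhd X P B)"
    by (intro card_Diff_subset finite_closed_nbhd closed_nbhd_subset repeated_subset)
  then show "(\<Union>i\<in>{1..m}. A i - B) = X - closed_nbhd X P B"
    using Union_minus_repeated_subset eqs(2) finite_X by (intro card_subset_eq) auto
qed

text \<open>With \<open>B\<close> empty the members are disjoint and cover \<open>X\<close>, so
  every point outside \<open>A 1\<close> lies in another member and is not adjacent to
  \<open>A 1\<close>. Connectedness then leaves no such point.\<close>

lemma disjoint_cross_family_trivial:
  assumes "connected_system X P" "A 1 \<noteq> {}" "m \<ge> 1" "B = {}" "(\<Union>i\<in>{1..m}. A i) = X"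
  shows "A 1 = X \<and> (\<forall>i\<in>{2..m}. A i = {})"
proof -
  have one: "1 \<in> {1..m}" using assms(3) by simp
  have disj: "A 1 \<inter> A i = {}" if "i \<in> {2..m}" for i
  proof (rule ccontr)
    assume "A 1 \<inter> A i \<noteq> {}"
    then obtain x where "x \<in> A 1" "x \<in> A i" by blast
    moreover have "i \<in> {1..m}" "1 \<noteq> i" using that by auto
    ultimately have "x \<in> B" using one unfolding B_def repeated_def by blast
    then show False using assms(4) by simp
  qed
  have "A 1 = X"
  proof (rule connected_component_eq[OF assms(1) member_subset[OF one] assms(2)])
    fix a b assume ab: "a \<in> A 1" "b \<in> X - A 1"
    then obtain i where "i \<in> {1..m}" "b \<in> A i" "i \<noteq> 1" using assms(5) by blast
    then show "{a, b} \<in> P" using cross one ab(1) unfolding cross_family_def by metis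
  qed
  moreover have "A i = {}" if "i \<in> {2..m}" for i
    using disj[OF that] member_subset[of i] that \<open>A 1 = X\<close> by auto
  ultimately show ?thesis by blast
qed

end

end

section \<open>The two bounds and their equality cases\<close>

theorem theorem2p5:
  fixes X :: "'a set" and P :: "'a set set" and m :: nat and A :: "nat \<Rightarrow> 'a set"
  assumes "finite X" and "P \<subseteq> Pow X"
    and "\<And>B C. C \<in> P \<Longrightarrow> B \<subseteq> C \<Longrightarrow> B \<in> P"
    and "\<And>B. B \<subseteq> X \<Longrightarrow> card B \<ge> 2 \<Longrightarrow>
           (\<forall>x \<in> B. \<forall>y \<in> B. x \<noteq> y \<longrightarrow> {x, y} \<in> P) \<Longrightarrow> B \<in> P"
    and "\<And>x. x \<in> X \<Longrightarrow> {x} \<in> P"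
    and "symmetric_system TYPE('g) X P"
    and "connected_system X P"
    and "m \<ge> 1"
    and "cross_family X P m A"
    and "A 1 \<noteq> {}"
  defines "r \<equiv> real (card X) / real (alpha P)"
    and "as_in_i \<equiv> A 1 = X \<and> (\<forall>i \<in> {2..m}. A i = {})"
    and "as_in_ii \<equiv> \<exists>I \<in> P. card I = alpha P \<and> (\<forall>i \<in> {1..m}. A i = I)"
  shows "(real m \<le> r \<longrightarrow> (\<Sum>i = 1..m. card (A i)) \<le> card X) \<and>
    (real m \<ge> r \<longrightarrow> (\<Sum>i = 1..m. card (A i)) \<le> m * alpha P) \<and>
    ((real m \<le> r \<longrightarrow> (\<Sum>i = 1..m. card (A i)) = card X) \<and>
     (real m \<ge> r \<longrightarrow> (\<Sum>i = 1..m. card (A i)) = m * alpha P)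
     \<longleftrightarrow>
       (real m < r \<and> as_in_i) \<or>
       (real m > r \<and> as_in_ii) \<or>
       (real m = r \<and>
         (as_in_i \<or> as_in_ii \<or>
          (\<exists>B. imprimitive_subset X P B \<and> (\<forall>i \<in> {1..m}. B \<subseteq> A i) \<and>
             cross_family X P m (\<lambda>i. A i - B) \<and>
             indexed_partition m (\<lambda>i. A i - B) (X - closed_nbhd X P B)))))"
proof -
  have "X \<noteq> {}"
    using assms(8-10) by (auto simp: cross_family_def)
  then interpret p_system X P
    using assms(1-5) by unfold_locales blast+
  define B where "B = repeated m A"
  define N where "N = closed_nbhd X P B"
  define S where "S = (\<Sum>i = 1..m. card (A i))"
  note cross = assms(9)
  have upper: "S + card N \<le> m * card B + card X"
    using sum_card_le[OF cross] by (simp add: S_def N_def B_def)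
  have BP: "B \<in> P" using repeated_in_P[OF cross] by (simp add: B_def)
  have ratio: "card B * card X \<le> alpha P * card N"
    using card_ratio_closed_nbhd[OF assms(6) BP] by (simp add: N_def)
  have b_le: "card B \<le> alpha P" by (rule card_le_alpha[OF BP])
  \<comment> \<open>Clearing the denominator turns every comparison with \<open>r\<close> into one
    between natural numbers.\<close>
  have r_iff: "real m \<le> r \<longleftrightarrow> m * alpha P \<le> card X" "real m \<ge> r \<longleftrightarrow> m * alpha P \<ge> card X"
    using alpha_pos unfolding r_def
    by (simp_all add: pos_le_divide_eq pos_divide_le_eq flip: of_nat_mult)
  have bound1: "S \<le> card X" if "m * alpha P \<le> card X"
  proof -
    have "alpha P * (m * card B) = card B * (m * alpha P)" by simp
    also have "\<dots> \<le> card B * card X" using that by (rule mult_le_mono2)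
    also note ratio
    finally have "m * card B \<le> card N" using alpha_pos by simp
    then show ?thesis using upper by linarith
  qed
  \<comment> \<open>This is \<open>upper\<close> multiplied by \<open>alpha P\<close>, with
    \<open>ratio\<close> inserted. The product on the left is the slack: it is kept because it must
    vanish when the bound is attained. The proof passes through the integers because both
    subtractions are truncated.\<close>
  have key: "alpha P * S + (alpha P - card B) * (m * alpha P - card X) \<le> alpha P * (m * alpha P)"
    if "card X \<le> m * alpha P"
  proof -
    have "int (alpha P) * (int S + int (card N)) \<le> int (alpha P) * (int m * int (card B) + int (card X))"
      using upper by (intro mult_left_mono) (simp_all flip: of_nat_mult of_nat_add)
    moreover have "int (card B) * int (card X) \<le> int (alpha P) * int (card N)"
      using ratio by (simp flip: of_nat_mult)
    ultimately have "int (alpha P) * int S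
        + (int (alpha P) - int (card B)) * (int m * int (alpha P) - int (card X))
        \<le> int (alpha P) * (int m * int (alpha P))"
      by (simp add: algebra_simps)
    then have "int (alpha P * S + (alpha P - card B) * (m * alpha P - card X))
        \<le> int (alpha P * (m * alpha P))"
      using that b_le by (simp add: of_nat_diff)
    then show ?thesis by (simp only: of_nat_le_iff)
  qed
  have bound2: "S \<le> m * alpha P" if "card X \<le> m * alpha P"
  proof -
    have "alpha P * S \<le> alpha P * (m * alpha P)" using key[OF that] by linarith
    then show ?thesis using alpha_pos by simp
  qed
  have below: "B \<subseteq> A i" if "S + card N = m * card B + card X" "i \<in> {1..m}" for i
    using sum_card_eqD(1)[OF cross] that unfolding S_def N_def B_def by blast
  have rest: "(\<Union>i\<in>{1..m}. A i - B) = X - N" if "S + card N = m * card B + card X"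
    using sum_card_eqD(2)[OF cross] that unfolding S_def N_def B_def by blast
  have finB: "finite B" using finite_repeated[OF cross] by (simp add: B_def)
  have N_sub: "N \<subseteq> X"
    using closed_nbhd_subset[OF repeated_subset[OF cross]] by (simp add: N_def B_def)
  have case_i: as_in_i if "S = card X" "B = {}"
  proof -
    have "N = {}" using that(2) by (simp add: N_def closed_nbhd_def)
    then have "(\<Union>i\<in>{1..m}. A i) = X" using rest that by simp
    then show ?thesis
      using disjoint_cross_family_trivial[OF cross assms(7,10,8)] that(2)
      by (simp add: as_in_i_def B_def)
  qed
  have case_ii: as_in_ii if "S = m * alpha P" "card B = alpha P"
  proof -
    \<comment> \<open>For \<open>B\<close> of maximum size the ratio inequality forces
      \<open>N = X\<close>, so nothing is left outside \<open>B\<close>.\<close>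
    have "alpha P * card X \<le> alpha P * card N" using ratio that(2) by simp
    then have "card X \<le> card N" using alpha_pos by simp
    then have "N = X" using N_sub finite_X by (intro card_seteq)
    then have eq: "S + card N = m * card B + card X" using that by simp
    then have "(\<Union>i\<in>{1..m}. A i - B) = {}" using rest \<open>N = X\<close> by simp
    then have "\<forall>i\<in>{1..m}. A i = B" using below[OF eq] by blast
    then show ?thesis unfolding as_in_ii_def using BP that(2) by blast
  qed
  have less_case: as_in_i if "m * alpha P < card X" "S = card X"
  proof -
    have "card N \<le> m * card B" using upper that(2) by simp
    then have "alpha P * card N \<le> alpha P * (m * card B)" by (rule mult_le_mono2)
    with ratio have "card B * card X \<le> alpha P * (m * card B)" by (rule le_trans)
    then have "card B * card X \<le> card B * (m * alpha P)" by (simp only: ac_simps)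
    \<comment> \<open>The strict inequality on \<open>m * alpha P\<close> would contradict this for
      positive \<open>card B\<close>.\<close>
    then have "B = {}" using that(1) finB by simp
    then show ?thesis using case_i that(2) by blast
  qed
  have greater_case: as_in_ii if "m * alpha P > card X" "S = m * alpha P"
  proof -
    have "(alpha P - card B) * (m * alpha P - card X) = 0" using key that by simp
    then have "card B = alpha P" using that(1) b_le by simp
    then show ?thesis by (rule case_ii[OF that(2)])
  qed
  have equal_case: "as_in_i \<or> as_in_ii \<or>
      (\<exists>B. imprimitive_subset X P B \<and> (\<forall>i \<in> {1..m}. B \<subseteq> A i) \<and>
         cross_family X P m (\<lambda>i. A i - B) \<and>
         indexed_partition m (\<lambda>i. A i - B) (X - closed_nbhd X P B))"
    if eq: "m * alpha P = card X" "S = card X"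
  proof -
    \<comment> \<open>At the threshold \<open>ratio\<close> and \<open>upper\<close> bound
      \<open>card N\<close> from both sides, so equality holds in \<open>upper\<close> for every
      possible size of \<open>B\<close>.\<close>
    have "alpha P * (m * card B) \<le> alpha P * card N" 
      using ratio unfolding eq(1)[symmetric] by (simp only: ac_simps)
    then have "m * card B \<le> card N" using alpha_pos by simp
    moreover have "card N \<le> m * card B" using upper eq(2) by simp
    ultimately have N: "card N = m * card B" by simp
    then have full: "S + card N = m * card B + card X" using eq(2) by simp
    consider "B = {}" | "card B = alpha P" | "B \<noteq> {}" "card B < alpha P"
      using b_le le_neq_implies_less by blast
    then show ?thesis
    proof cases
      case 1
      then show ?thesis using case_i eq(2) by blast
    next
      case 2
      then show ?thesis using case_ii eq by simp
    next
      case 3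
      \<comment> \<open>Both quotients in the definition equal \<open>1 / m\<close>.\<close>
      have "imprimitive_subset X P B"
        using 3 BP N eq(1)[symmetric] finB assms(8) alpha_pos
        by (simp add: imprimitive_subset_def N_def[symmetric] field_simps)
      moreover have "cross_family X P m (\<lambda>i. A i - B)"
        using cross by (auto simp: cross_family_def)
      moreover have "indexed_partition m (\<lambda>i. A i - B) (X - closed_nbhd X P B)"
        using disjoint_family_minus_repeated[of A m] rest[OF full]
        by (simp add: indexed_partition_def B_def[symmetric] N_def[symmetric])
      ultimately show ?thesis using below[OF full] by blast
    qed
  qed
  have from_i: "S = card X" if as_in_i
    using that assms(8) unfolding as_in_i_def S_def
    by (simp add: sum.atLeast_Suc_atMost numeral_2_eq_2)
  have from_ii: "S = m * alpha P" if as_in_ii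
    using that unfolding as_in_ii_def S_def by auto
  have from_iii: "S = card X" if "m * alpha P = card X" "imprimitive_subset X P C"
    "\<forall>i\<in>{1..m}. C \<subseteq> A i" "indexed_partition m (\<lambda>i. A i - C) (X - closed_nbhd X P C)" for C
  proof -
    let ?M = "closed_nbhd X P C"
    have "C \<subseteq> X" using that(2) P_subset by (auto simp: imprimitive_subset_def)
    note M = finite_closed_nbhd[OF this] closed_nbhd_subset[OF this]
    have "C \<noteq> {}" "C \<subseteq> ?M"
      using that(2) by (auto simp: imprimitive_subset_def closed_nbhd_def)
    then have "card ?M > 0" using M(1) by (auto simp: card_gt_0_iff)
    moreover have "real (card C) / real (card ?M) = real (alpha P) / real (card X)"
      using that(2) by (simp add: imprimitive_subset_def)
    moreover have "card X > 0" using finite_X nonempty by (simp add: card_gt_0_iff)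
    ultimately have "real (card C) * real (card X) = real (alpha P) * real (card ?M)"
      by (simp add: frac_eq_eq)
    then have "card C * card X = alpha P * card ?M" by (simp only: of_nat_eq_iff flip: of_nat_mult)
    then have "alpha P * (m * card C) = alpha P * card ?M"
      unfolding that(1)[symmetric] by (simp only: ac_simps)
    then have "m * card C = card ?M" using alpha_pos by simp
    \<comment> \<open>The common part \<open>C\<close> is counted \<open>m\<close> times and the
      partition covers the rest once; since \<open>m * card C = card ?M\<close>, the total is
      \<open>card X\<close>.\<close>
    moreover have "S = m * card C + card (X - ?M)"
      unfolding S_def using that(3,4) finite_member[OF cross]
      by (subst sum_card_eq_common[where B = C]) (auto simp: indexed_partition_def)
    moreover have "card (X - ?M) = card X - card ?M" using M by (intro card_Diff_subset)
    moreover have "card ?M \<le> card X" using M(2) finite_X by (rule card_mono[rotated])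
    ultimately show ?thesis by linarith
  qed
  have r_strict: "real m < r \<longleftrightarrow> m * alpha P < card X" "real m > r \<longleftrightarrow> m * alpha P > card X"
    "real m = r \<longleftrightarrow> m * alpha P = card X"
    using r_iff by linarith+
  show ?thesis
    unfolding S_def[symmetric] r_iff r_strict
  proof (intro conjI)
    show "m * alpha P \<le> card X \<longrightarrow> S \<le> card X" using bound1 by blast
    show "card X \<le> m * alpha P \<longrightarrow> S \<le> m * alpha P" using bound2 by blast
  next
    let ?iii = "\<exists>B. imprimitive_subset X P B \<and> (\<forall>i \<in> {1..m}. B \<subseteq> A i) \<and>
       cross_family X P m (\<lambda>i. A i - B) \<and>
       indexed_partition m (\<lambda>i. A i - B) (X - closed_nbhd X P B)"
    show "((m * alpha P \<le> card X \<longrightarrow> S = card X) \<and> (card X \<le> m * alpha P \<longrightarrow> S = m * alpha P))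
      \<longleftrightarrow> (m * alpha P < card X \<and> as_in_i) \<or> (card X < m * alpha P \<and> as_in_ii) \<or>
        (m * alpha P = card X \<and> (as_in_i \<or> as_in_ii \<or> ?iii))"
    proof (cases "m * alpha P" "card X" rule: linorder_cases)
      case less
      then show ?thesis using less_case from_i by auto
    next
      case equal
      \<comment> \<open>At the threshold the two bounds coincide, so attaining either of them means
        \<open>S = card X\<close>.\<close>
      have "S = card X \<longleftrightarrow> as_in_i \<or> as_in_ii \<or> ?iii"
        using equal_case[OF equal] from_i from_ii from_iii[OF equal] equal by metis
      then show ?thesis using equal by simp
    next
      case greater
      then show ?thesis using greater_case from_ii by auto
    qed
  qed
qed

end
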